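(* Fix $0<\gamma<\tfrac12$, and let $\alpha\in[0,1)$ satisfy $$2\gamma = 1-(1-w(\alpha))(\alpha+w(\alpha)),\qquad\text{where } w(\alpha)=1-(1-\alpha)\lfloor (1-\alpha)^{-1}\rfloor .$$ Let $(G_i)_{i\ge1}$ be a sequence of directed graphs, where $G_i$ has $n_i$ vertices and is $(p_i,r_i)$-pseudorandom, such that $p_i n_i\to\infty$ and $r_i=O(\sqrt{n_ip_i})$ as $i\to\infty$. Then there exist a sequence $\varepsilon_i\to0$ and subgraphs $G_i'\subseteq G_i$ such that, for all sufficiently large $i$, $G_i'$ has $\lceil(\tfrac12+\gamma)|E(G_i)|\rceil$ edges and $G_i'$ does not contain any directed cycle of length at least $(1-\alpha+\varepsilon_i)\,n_i$.
   Context: Directed graphs are finite, without loops or multiple parallel edges, but antiparallel edges (both $xy$ and $yx$) are allowed. A directed graph $G=(V,E)$ on $n$ vertices has edge density $p$ if $|E|=pn^2$. For disjoint $A,B\subseteq V$, $e_G(A,B)$ denotes the number of edges of $G$ directed from $A$ to $B$. $G$ is $(p,r)$-pseudorandom if it has edge density $p$ and for every two disjoint sets $A,B\subseteq V$ with $|A|=|B|$, $$\bigl|e_G(A,B)-p|A||B|\bigr|\le r|A|\sqrt{pn}.$$ Directed cycles are simple; the length of a cycle is its number of edges (equivalently vertices). *)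

theory Defs
  imports
    "HOL-Library.Landau_Symbols"
    "Graph_Theory.Graph_Theory"
begin

definition edge_density :: "('a, 'b) pre_digraph \<Rightarrow> real \<Rightarrow> bool" where
  "edge_density G p \<longleftrightarrow> real (card (arcs G)) = p * real (card (verts G)) ^ 2"

definition edges_between :: "('a, 'b) pre_digraph \<Rightarrow> 'a set \<Rightarrow> 'a set \<Rightarrow> nat" where
  "edges_between G A B = card {e \<in> arcs G. tail G e \<in> A \<and> head G e \<in> B}"

definition pseudorandom :: "('a, 'b) pre_digraph \<Rightarrow> real \<Rightarrow> real \<Rightarrow> bool" where
  "pseudorandom G p r \<longleftrightarrow>
     edge_density G p \<and>
     (\<forall>A B. A \<subseteq> verts G \<longrightarrow> B \<subseteq> verts G \<longrightarrow> A \<inter> B = {} \<longrightarrow> card A = card B \<longrightarrow>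
        \<bar>real (edges_between G A B) - p * real (card A) * real (card B)\<bar>
          \<le> r * real (card A) * sqrt (p * real (card (verts G))))"

definition w :: "real \<Rightarrow> real" where
  "w \<alpha> = 1 - (1 - \<alpha>) * of_int \<lfloor>inverse (1 - \<alpha>)\<rfloor>"

end

theory Submission
  imports Defs "HOL-Combinatorics.Permutations" "HOL-Real_Asymp.Real_Asymp"
begin

text \<open>
  Write \<open>t = 1 - \<alpha>\<close>. Split the \<open>n\<close> vertices of a digraph into consecutive blocks, each of size
  slightly more than \<open>t * n\<close> except for a smaller last one, and keep exactly the arcs that stay
  inside a block or lead to a later block. A directed cycle can never come back to an earlier
  block, so every cycle of the remaining digraph lies inside one block and its length is at most
  the block size.

  If the vertices are placed into the blocks uniformly at random, then every arc sees a uniformly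
  random ordered pair of distinct places. It is kept with probability one half plus half the
  probability that both places lie in the same block, that is, about \<open>(1 + S) / 2\<close> where \<open>S\<close> is the
  sum of the squares of the relative block sizes. For blocks of relative size exactly \<open>t\<close>, the
  hypothesis on \<open>\<gamma>\<close> says precisely that \<open>S = 2 * \<gamma>\<close> (\<open>gamma_as_block_squares\<close>). Hence some
  placement keeps a proportion of about \<open>1 / 2 + \<gamma>\<close> of the arcs (\<open>exists_placement\<close>).

  For the exact count the average has to reach \<open>(1 / 2 + \<gamma>) * |E|\<close> itself; superfluous arcs can
  then be deleted. Discreteness costs a term of order \<open>n\<close> in the number of pairs inside a block,
  because the two ends of an arc are distinct. It is recovered by enlarging the blocks
  from \<open>t * n\<close> to \<open>t * n + sqrt n\<close>: the sum of squares is convex in the block size, so it grows by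
  at least \<open>2 * n\<close> (\<open>block_squares_enlarged\<close>), while the relative block size changes by
  only \<open>O(1 / sqrt n)\<close>, which is the sequence \<open>\<epsilon>\<close>. This is asymptotically harmless because the
  number of vertices tends to infinity: a digraph has at most \<open>n^2\<close> arcs, so \<open>p \<le> 1\<close>
  and \<open>n \<ge> p * n\<close>.
\<close>

section \<open>Averaging over placements of the vertices\<close>

lemma permutes_pair_transitive:
  assumes "u \<in> V" "v \<in> V" "u' \<in> V" "v' \<in> V" and "u \<noteq> v" "u' \<noteq> v'"
  shows "\<exists>\<tau>. \<tau> permutes V \<and> \<tau> u = u' \<and> \<tau> v = v'"
proof -
  let ?\<sigma> = "transpose u u'"
  have \<sigma>: "?\<sigma> permutes V"
    using assms by (simp add: permutes_swap_id)
  then have "?\<sigma> v \<in> V"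
    using assms by (simp add: permutes_in_image)
  then have "(transpose (?\<sigma> v) v' \<circ> ?\<sigma>) permutes V"
    using assms \<sigma> by (intro permutes_compose permutes_swap_id)
  moreover have "?\<sigma> v \<noteq> u'"
    using assms by (metis transpose_apply_first transpose_eq_iff)
  ultimately show ?thesis
    using assms by (intro exI[of _ "transpose (?\<sigma> v) v' \<circ> ?\<sigma>"])
      (simp add: transpose_apply_other)
qed

text \<open>
  For a random permutation \<open>\<pi>\<close> the expectation of \<open>W (\<pi> u) (\<pi> v)\<close> is the same for all pairs of
  distinct \<open>u\<close> and \<open>v\<close>, since composition with a permutation moving one pair to another
  permutes the sample space. It therefore equals the mean of \<open>W\<close> over the off-diagonal
  pairs, and some permutation does at least as well as the expectation of the sum over \<open>E\<close>.
\<close>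

lemma exists_permutation_at_least_average:
  fixes W :: "'a \<Rightarrow> 'a \<Rightarrow> real"
  assumes V: "finite V" and E: "finite E"
    and ends: "\<And>e. e \<in> E \<Longrightarrow> t e \<in> V \<and> h e \<in> V \<and> t e \<noteq> h e"
  shows "\<exists>\<pi>. \<pi> permutes V \<and>
    real (card E) * (\<Sum>(u, v)\<in>{(u, v) \<in> V \<times> V. u \<noteq> v}. W u v)
      \<le> real (card V) * (real (card V) - 1) * (\<Sum>e\<in>E. W (\<pi> (t e)) (\<pi> (h e)))"
proof -
  define P where "P = {\<pi>. \<pi> permutes V}"
  define D where "D = {(u, v) \<in> V \<times> V. u \<noteq> v}"
  define T where "T = (\<Sum>(u, v)\<in>D. W u v)"
  define M where "M u v = (\<Sum>\<pi>\<in>P. W (\<pi> u) (\<pi> v))" for u v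
  let ?N = "real (card V) * (real (card V) - 1)"
  have finP: "finite P" and neP: "P \<noteq> {}"
    using V permutes_id[of V] unfolding P_def by (blast intro: finite_permutations)+
  have finD: "finite D"
    using V by (auto simp: D_def intro: finite_subset[of _ "V \<times> V"])
  have "D = V \<times> V - (\<lambda>u. (u, u)) ` V"
    by (auto simp: D_def)
  moreover have "card ((\<lambda>u. (u, u)) ` V) = card V"
    by (rule card_image) (simp add: inj_on_def)
  ultimately have "card D = card V * card V - card V"
    using V card_Diff_subset[of "(\<lambda>u. (u, u)) ` V" "V \<times> V"]
    by (auto simp: card_cartesian_product)
  then have cardD: "real (card D) = ?N"
    by (cases "card V") (auto simp: algebra_simps of_nat_diff)
  \<comment> \<open>\<open>M u v\<close> is the expectation, up to the factor \<open>card P\<close>.\<close>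
  have shift: "M (\<tau> u) (\<tau> v) = M u v" if "\<tau> permutes V" for \<tau> u v
  proof -
    have "bij_betw (\<lambda>\<pi>. \<pi> \<circ> \<tau>) P P"
      by (rule bij_betwI[where g = "\<lambda>\<pi>. \<pi> \<circ> inv \<tau>"])
        (auto simp: P_def permutes_compose permutes_inv that o_assoc[symmetric]
          permutes_inv_o[OF that])
    from sum.reindex_bij_betw[OF this, of "\<lambda>\<pi>. W (\<pi> u) (\<pi> v)"]
    show ?thesis by (simp add: M_def)
  qed
  have M_const: "M u v = M u' v'" if "(u, v) \<in> D" "(u', v') \<in> D" for u v u' v'
    using permutes_pair_transitive[of u V v u' v'] that shift[of _ u v]
    by (fastforce simp: D_def)
  have M_sum: "(\<Sum>(u, v)\<in>D. M u v) = real (card P) * T"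
  proof -
    have T_perm: "(\<Sum>(u, v)\<in>D. W (\<pi> u) (\<pi> v)) = T" if "\<pi> \<in> P" for \<pi>
    proof -
      have \<pi>: "\<pi> permutes V" using that by (simp add: P_def)
      have "bij_betw (\<lambda>(u, v). (\<pi> u, \<pi> v)) D D"
        by (rule bij_betwI[where g = "\<lambda>(u, v). (inv \<pi> u, inv \<pi> v)"])
          (auto simp: D_def permutes_in_image[OF \<pi>] permutes_inverses[OF \<pi>]
            permutes_in_image[OF permutes_inv[OF \<pi>]]
            dest: injD[OF permutes_inj[OF \<pi>]]
              injD[OF permutes_inj[OF permutes_inv[OF \<pi>]]])
      from sum.reindex_bij_betw[OF this, of "\<lambda>(u, v). W u v"]
      show ?thesis by (simp add: T_def case_prod_unfold)
    qed
    have "(\<Sum>(u, v)\<in>D. M u v) = (\<Sum>\<pi>\<in>P. \<Sum>(u, v)\<in>D. W (\<pi> u) (\<pi> v))"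
      unfolding M_def case_prod_unfold by (rule sum.swap)
    also have "\<dots> = (\<Sum>\<pi>\<in>P. T)"
      using T_perm by (rule sum.cong[OF refl])
    finally show ?thesis by simp
  qed
  have M_value: "?N * M u v = real (card P) * T" if "(u, v) \<in> D" for u v
  proof -
    have "(\<Sum>(u', v')\<in>D. M u' v') = (\<Sum>x\<in>D. M u v)"
      using M_const[OF _ that] by (intro sum.cong) auto
    then show ?thesis unfolding M_sum cardD[symmetric] by simp
  qed
  have "(\<Sum>\<pi>\<in>P. ?N * (\<Sum>e\<in>E. W (\<pi> (t e)) (\<pi> (h e))))
      = ?N * (\<Sum>e\<in>E. M (t e) (h e))"
    unfolding M_def sum_distrib_left[symmetric] by (subst sum.swap) (rule refl)
  also have "\<dots> = (\<Sum>e\<in>E. real (card P) * T)"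
    unfolding sum_distrib_left
  proof (rule sum.cong[OF refl])
    fix e assume "e \<in> E"
    then show "?N * M (t e) (h e) = real (card P) * T"
      using ends by (intro M_value) (simp add: D_def)
  qed
  also have "\<dots> = (\<Sum>\<pi>\<in>P. real (card E) * T)"
    by simp
  finally have avg: "(\<Sum>\<pi>\<in>P. ?N * (\<Sum>e\<in>E. W (\<pi> (t e)) (\<pi> (h e))))
      = (\<Sum>\<pi>\<in>P. real (card E) * T)" .
  have "\<exists>\<pi>\<in>P. real (card E) * T \<le> ?N * (\<Sum>e\<in>E. W (\<pi> (t e)) (\<pi> (h e)))"
  proof (rule ccontr)
    assume "\<not> ?thesis"
    then have "(\<Sum>\<pi>\<in>P. ?N * (\<Sum>e\<in>E. W (\<pi> (t e)) (\<pi> (h e))))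
        < (\<Sum>\<pi>\<in>P. real (card E) * T)"
      using finP neP by (intro sum_strict_mono) auto
    then show False using avg by simp
  qed
  then show ?thesis by (auto simp: P_def T_def D_def)
qed

text \<open>
  Each unordered pair with different labels is counted in exactly one orientation, each pair with
  equal labels in both. The class sizes on the right count the diagonal as well, which explains the
  term \<open>- 2 * card V\<close>: one diagonal is missing from the pairs in \<open>V \<times> V\<close>, one from
  the equally labelled pairs.
\<close>

lemma sum_weakly_ordered_pairs:
  fixes f :: "'a \<Rightarrow> 'c :: linorder"
  assumes "finite V"
  shows "2 * (\<Sum>(u, v)\<in>{(u, v) \<in> V \<times> V. u \<noteq> v}. of_bool (f u \<le> f v) :: real)
    = real (card V)^2 - 2 * real (card V) + (\<Sum>u\<in>V. real (card {v \<in> V. f v = f u}))"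
proof -
  let ?D = "{(u, v) \<in> V \<times> V. u \<noteq> v}"
  let ?S = "\<Sum>u\<in>V. \<Sum>v\<in>V. of_bool (f u \<le> f v) :: real"
  have "V \<times> V = ?D \<union> (\<lambda>u. (u, u)) ` V" "?D \<inter> (\<lambda>u. (u, u)) ` V = {}"
    by auto
  moreover have "finite ?D"
    using assms by (auto intro: finite_subset[of _ "V \<times> V"])
  ultimately have "(\<Sum>(u, v)\<in>V \<times> V. of_bool (f u \<le> f v) :: real)
      = (\<Sum>(u, v)\<in>?D. of_bool (f u \<le> f v)) + (\<Sum>(u, v)\<in>(\<lambda>u. (u, u)) ` V. of_bool (f u \<le> f v))"
    using assms by (metis (no_types, lifting) finite_imageI sum.union_disjoint)
  also have "(\<Sum>(u, v)\<in>(\<lambda>u. (u, u)) ` V. of_bool (f u \<le> f v) :: real) = real (card V)"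
    by (subst sum.reindex) (auto simp: inj_on_def)
  finally have diag: "?S = (\<Sum>(u, v)\<in>?D. of_bool (f u \<le> f v)) + real (card V)"
    by (simp add: sum.cartesian_product)
  have "?S = (\<Sum>u\<in>V. \<Sum>v\<in>V. of_bool (f v \<le> f u))"
    by (rule sum.swap)
  then have "2 * ?S = (\<Sum>u\<in>V. \<Sum>v\<in>V. of_bool (f u \<le> f v) + of_bool (f v \<le> f u))"
    by (simp add: sum.distrib)
  also have "\<dots> = (\<Sum>u\<in>V. \<Sum>v\<in>V. 1 + of_bool (f v = f u))"
    by (intro sum.cong refl) auto
  also have "\<dots> = real (card V)^2 + (\<Sum>u\<in>V. real (card {v \<in> V. f v = f u}))"
    using assms by (simp add: sum.distrib power2_eq_square sum.If_cases of_bool_def Int_def)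
  finally show ?thesis using diag by simp
qed

lemma (in digraph) exists_placement:
  fixes f :: "'a \<Rightarrow> 'c :: linorder"
  shows "\<exists>\<pi>. \<pi> permutes verts G \<and>
    real (card (arcs G)) * (real (card (verts G))^2 - 2 * real (card (verts G))
        + (\<Sum>u\<in>verts G. real (card {v \<in> verts G. f v = f u})))
      \<le> 2 * real (card (verts G)) * (real (card (verts G)) - 1)
        * real (card {e \<in> arcs G. f (\<pi> (tail G e)) \<le> f (\<pi> (head G e))})"
proof -
  obtain \<pi> where \<pi>: "\<pi> permutes verts G"
    and le: "real (card (arcs G)) *
        (\<Sum>(u, v)\<in>{(u, v) \<in> verts G \<times> verts G. u \<noteq> v}. of_bool (f u \<le> f v))
      \<le> real (card (verts G)) * (real (card (verts G)) - 1)
        * (\<Sum>e\<in>arcs G. of_bool (f (\<pi> (tail G e)) \<le> f (\<pi> (head G e))))"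
    using exists_permutation_at_least_average[of "verts G" "arcs G" "tail G" "head G"
        "\<lambda>u v. of_bool (f u \<le> f v)"] no_loops by auto
  have "(\<Sum>e\<in>arcs G. of_bool (f (\<pi> (tail G e)) \<le> f (\<pi> (head G e))) :: real)
      = real (card {e \<in> arcs G. f (\<pi> (tail G e)) \<le> f (\<pi> (head G e))})"
    by (simp add: sum.If_cases of_bool_def Int_def)
  then show ?thesis
    using \<pi> le unfolding sum_weakly_ordered_pairs[OF finite_verts, of f, symmetric]
    by (intro exI[of _ \<pi>]) (simp add: algebra_simps)
qed

section \<open>Cycles and vertex labels that do not decrease along arcs\<close>

text \<open>
  Labels can only grow along a walk; on a closed walk they are thus squeezed to a constant.
\<close>

lemma (in wf_digraph) awalk_label_bounds:
  fixes f :: "'a \<Rightarrow> 'c :: linorder"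
  assumes mono: "\<And>e. e \<in> arcs G \<Longrightarrow> f (tail G e) \<le> f (head G e)"
    and "awalk u c v" and "x \<in> set (awalk_verts u c)"
  shows "f u \<le> f x \<and> f x \<le> f v"
  using assms(2,3)
proof (induction c arbitrary: u x)
  case Nil
  then show ?case by (simp add: awalk_Nil_iff)
next
  case (Cons e c)
  then have e: "e \<in> arcs G" "tail G e = u" and walk: "awalk (head G e) c v"
    by (auto simp: awalk_Cons_iff)
  have "f u \<le> f (head G e)"
    using mono e by auto
  moreover have "f (head G e) \<le> f v"
    using Cons.IH[OF walk] hd_in_awalk_verts(1)[OF walk] by blast
  moreover have "x = u \<or> x \<in> set (awalk_verts (head G e) c)"
    using Cons.prems e by auto
  ultimately show ?case
    using Cons.IH[OF walk] by force
qed

lemma (in wf_digraph) cycle_length_le_label_class: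
  fixes f :: "'a \<Rightarrow> 'c :: linorder"
  assumes mono: "\<And>e. e \<in> arcs G \<Longrightarrow> f (tail G e) \<le> f (head G e)"
    and fin: "finite (verts G)" and "cycle c"
  shows "\<exists>u\<in>verts G. length c \<le> card {v \<in> verts G. f v = f u}"
proof -
  obtain u where walk: "awalk u c u" and dist: "distinct (tl (awalk_verts u c))"
    using \<open>cycle c\<close> by (auto simp: cycle_def)
  have u: "u \<in> verts G"
    using walk by (auto simp: awalk_def)
  have "set (tl (awalk_verts u c)) \<subseteq> {v \<in> verts G. f v = f u}"
  proof
    fix x assume "x \<in> set (tl (awalk_verts u c))"
    then have x: "x \<in> set (awalk_verts u c)"
      by (metis awalk_verts_non_Nil list.set_sel(2))
    then show "x \<in> {v \<in> verts G. f v = f u}"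
      using awalk_label_bounds[OF mono walk x] awalk_verts_in_verts[OF u _ x] walk
      by (auto simp: awalk_def)
  qed
  then have "card (set (tl (awalk_verts u c))) \<le> card {v \<in> verts G. f v = f u}"
    using fin by (intro card_mono) auto
  then have "length c \<le> card {v \<in> verts G. f v = f u}"
    using distinct_card[OF dist] by (simp add: length_awalk_verts)
  then show ?thesis using u by blast
qed

section \<open>Sizes of consecutive blocks\<close>

lemma div_eq_iff_in_block:
  fixes m b j :: nat
  assumes "m > 0"
  shows "b div m = j \<longleftrightarrow> b \<in> {j * m..<j * m + m}"
proof
  assume "b div m = j"
  then show "b \<in> {j * m..<j * m + m}"
    using div_mult_mod_eq[of b m] mod_less_divisor[OF assms, of b] by auto
next
  assume "b \<in> {j * m..<j * m + m}"
  then show "b div m = j"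
    by (intro div_nat_eqI) (auto simp: mult.commute)
qed

lemma card_div_class_le:
  fixes m n a :: nat
  assumes "m > 0"
  shows "card {b \<in> {..<n}. b div m = a div m} \<le> m"
proof -
  have "{b \<in> {..<n}. b div m = a div m} \<subseteq> {a div m * m..<a div m * m + m}"
    unfolding div_eq_iff_in_block[OF assms] by blast
  from card_mono[OF _ this] show ?thesis by simp
qed

text \<open>
  The places \<open>0, ..., n - 1\<close> fall into \<open>q\<close> full blocks of size \<open>m\<close> and one last block of
  size \<open>n - q * m\<close>, possibly empty or full; a place in a block of size \<open>s\<close> contributes \<open>s\<close>, so the
  block contributes \<open>s^2\<close>.
\<close>

lemma sum_card_div_classes:
  fixes q m n :: nat
  assumes m: "m > 0" and lo: "q * m \<le> n" and hi: "n \<le> (q + 1) * m"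
  shows "(\<Sum>a<n. real (card {b \<in> {..<n}. b div m = a div m}))
    = real q * real m^2 + (real n - real q * real m)^2"
proof -
  have full: "card {b \<in> {..<n}. b div m = a div m} = m" if "a < q * m" for a
  proof -
    have "a div m < q"
      using that m by (simp add: less_mult_imp_div_less)
    then have "(a div m + 1) * m \<le> q * m"
      by (intro mult_right_mono) auto
    then have le: "a div m * m + m \<le> n"
      using lo by simp
    have "{b \<in> {..<n}. b div m = a div m} = {a div m * m ..< a div m * m + m}"
      unfolding div_eq_iff_in_block[OF m] using le by auto
    then show ?thesis by simp
  qed
  have last: "card {b \<in> {..<n}. b div m = a div m} = n - q * m" if "q * m \<le> a" "a < n" for a
  proof -
    have div_q: "b div m = q" if "q * m \<le> b" "b < n" for b
      using that hi by (intro div_nat_eqI) (auto simp: mult.commute)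
    have "{b \<in> {..<n}. b div m = q} = {q * m..<n}"
      unfolding div_eq_iff_in_block[OF m] using hi by auto
    then have "{b \<in> {..<n}. b div m = a div m} = {q * m..<n}"
      using div_q[OF that] by simp
    then show ?thesis by simp
  qed
  have "{..<n} = {..<q * m} \<union> {q * m..<n}"
    using lo by auto
  then have "(\<Sum>a<n. real (card {b \<in> {..<n}. b div m = a div m}))
    = (\<Sum>a<q * m. real (card {b \<in> {..<n}. b div m = a div m}))
      + (\<Sum>a=q * m..<n. real (card {b \<in> {..<n}. b div m = a div m}))"
    by (metis (no_types, lifting) finite_atLeastLessThan finite_lessThan ivl_disj_int_one(2) sum.union_disjoint)
  also have "\<dots> = (\<Sum>a<q * m. real m) + (\<Sum>a=q * m..<n. real (n - q * m))"
    using full last by (intro arg_cong2[where f = "(+)"] sum.cong) auto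
  finally show ?thesis
    using lo by (simp add: power2_eq_square of_nat_diff)
qed

text \<open>
  As a function of the block size \<open>x\<close>, the sum of squares is a quadratic polynomial with leading
  coefficient \<open>q * (q + 1)\<close> and minimum at \<open>x = n / (q + 1)\<close>, the case of equal blocks. Beyond the
  minimum it grows at least as fast as its quadratic term. At the minimum itself there is no linear
  gain, so an enlargement of order \<open>sqrt n\<close> is what a gain of order \<open>n\<close> requires.
\<close>

lemma block_squares_enlarged:
  fixes q n x y c :: real
  assumes "q \<ge> 1" and "n \<le> (q + 1) * x" and "x + c \<le> y" and "c \<ge> 0"
  shows "q * x^2 + (n - q * x)^2 + 2 * c^2 \<le> q * y^2 + (n - q * y)^2"
proof -
  have id: "q * y^2 + (n - q * y)^2 - (q * x^2 + (n - q * x)^2)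
      = q * (q + 1) * (y - x)^2 + 2 * q * (y - x) * ((q + 1) * x - n)"
    by algebra
  have "1 * 2 \<le> q * (q + 1)"
    using assms by (intro mult_mono) auto
  moreover have "c^2 \<le> (y - x)^2"
    using assms by (intro power_mono) auto
  ultimately have "2 * c^2 \<le> q * (q + 1) * (y - x)^2"
    by (intro mult_mono) auto
  moreover have "0 \<le> 2 * q * (y - x) * ((q + 1) * x - n)"
    using assms by (intro mult_nonneg_nonneg) auto
  ultimately show ?thesis using id by linarith
qed

text \<open>
  In terms of \<open>k = \<lfloor>1 / (1 - \<alpha>)\<rfloor>\<close> the right-hand side of the hypothesis is the sum of squares for \<open>k\<close>
  blocks of size \<open>1 - \<alpha>\<close> and a remainder of size \<open>w \<alpha>\<close>. The number \<open>q\<close> of full blocks is chosen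
  with \<open>q * (1 - \<alpha>) < 1\<close> strictly, so that \<open>q\<close> blocks still fit after a small enlargement. If the
  remainder vanishes, this means \<open>q = k - 1\<close>, and the last full block takes the role of the
  remainder.
\<close>

lemma gamma_as_block_squares:
  fixes \<gamma> \<alpha> :: real
  assumes "\<gamma> < 1 / 2" "0 \<le> \<alpha>" "\<alpha> < 1"
    and \<gamma>: "2 * \<gamma> = 1 - (1 - w \<alpha>) * (\<alpha> + w \<alpha>)"
  shows "\<exists>q::nat. q \<ge> 1 \<and> real q * (1 - \<alpha>) < 1 \<and> 1 \<le> (real q + 1) * (1 - \<alpha>) \<and>
    2 * \<gamma> = real q * (1 - \<alpha>)^2 + (1 - real q * (1 - \<alpha>))^2"
proof -
  define t where "t = 1 - \<alpha>"
  define k where "k = \<lfloor>inverse t\<rfloor>"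
  have t: "0 < t" "t \<le> 1" using assms by (auto simp: t_def)
  have w_eq: "w \<alpha> = 1 - t * of_int k"
    by (simp add: w_def t_def k_def)
  have \<gamma>_k: "2 * \<gamma> = of_int k * t^2 + (1 - of_int k * t)^2"
    using \<gamma> unfolding w_eq by (simp add: t_def power2_eq_square algebra_simps)
  \<comment> \<open>A single block would be the whole vertex set, and nothing would have to be deleted:
      this is \<open>\<gamma> = 1 / 2\<close>.\<close>
  have "t \<noteq> 1"
  proof
    assume "t = 1"
    then have "k = 1" by (simp add: k_def)
    with \<open>t = 1\<close> \<gamma>_k assms(1) show False by simp
  qed
  then have t1: "t < 1" using t by simp
  have "1 \<le> k"
    using t by (simp add: k_def le_floor_iff one_le_inverse)
  have "of_int k \<le> inverse t" "inverse t < of_int k + 1"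
    by (simp_all add: k_def)
  then have kt: "of_int k * t \<le> 1" "1 < (of_int k + 1) * t"
    using t by (simp_all add: field_simps)
  show ?thesis
  proof (cases "of_int k * t = 1")
    case False
    then show ?thesis
      using kt \<open>1 \<le> k\<close> \<gamma>_k unfolding t_def[symmetric]
      by (intro exI[of _ "nat k"]) auto
  next
    case True
    then have "k \<noteq> 1" using t1 by auto
    then have "2 \<le> k" using \<open>1 \<le> k\<close> by simp
    define q where "q = nat (k - 1)"
    have q: "real q = of_int k - 1" "q \<ge> 1"
      using \<open>2 \<le> k\<close> by (auto simp: q_def)
    have qt: "real q * t = 1 - t"
      using True by (simp add: q algebra_simps)
    have "real q * t^2 + (1 - real q * t)^2 = (real q * t) * t + (1 - real q * t)^2"
      by (simp add: power2_eq_square)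
    also have "\<dots> = (of_int k * t) * t + (1 - of_int k * t)^2"
      unfolding qt True by (simp add: power2_eq_square algebra_simps)
    also have "\<dots> = 2 * \<gamma>"
      unfolding \<gamma>_k by (simp add: power2_eq_square)
    finally have "2 * \<gamma> = real q * t^2 + (1 - real q * t)^2" ..
    moreover have "real q * t < 1" "1 \<le> (real q + 1) * t"
      using qt t by (simp_all add: algebra_simps)
    ultimately show ?thesis
      using q(2) unfolding t_def[symmetric] by (intro exI[of _ q]) auto
  qed
qed

section \<open>Dense subgraphs without long cycles\<close>

text \<open>
  The combinatorial core for a single digraph. The summand \<open>n\<close> on the left of the last assumption
  compensates for the diagonal pairs in the squares of the block sizes.
\<close>

lemma (in digraph) exists_block_subgraph:
  fixes \<gamma> :: real and q m :: nat
  defines "n \<equiv> card (verts G)"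
  assumes n: "n \<ge> 2" and "0 \<le> \<gamma>"
    and m: "m > 0" and lo: "q * m \<le> n" and hi: "n \<le> (q + 1) * m"
    and big: "2 * \<gamma> * real n^2 + real n \<le> real q * real m^2 + (real n - real q * real m)^2"
  shows "\<exists>H. subgraph H G \<and>
    int (card (arcs H)) = \<lceil>(1 / 2 + \<gamma>) * real (card (arcs G))\<rceil> \<and>
    (\<forall>c. pre_digraph.cycle H c \<longrightarrow> length c \<le> m)"
proof -
  obtain g where g: "bij_betw g (verts G) {..<n}"
    using ex_bij_betw_finite_nat[OF finite_verts] by (auto simp: n_def atLeast0LessThan)
  define f where "f v = g v div m" for v
  have class_eq: "card {v \<in> verts G. f v = f u} = card {b \<in> {..<n}. b div m = g u div m}" for u
  proof -
    have "g ` {v \<in> verts G. f v = f u} = {b \<in> {..<n}. b div m = g u div m}"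
      using g by (auto simp: f_def bij_betw_def)
    moreover have "inj_on g {v \<in> verts G. f v = f u}"
      using g by (auto simp: bij_betw_def inj_on_def)
    ultimately show ?thesis by (simp flip: card_image)
  qed
  have "(\<Sum>u\<in>verts G. real (card {v \<in> verts G. f v = f u}))
      = (\<Sum>a<n. real (card {b \<in> {..<n}. b div m = a div m}))"
    unfolding class_eq using sum.reindex_bij_betw[OF g] .
  then have classes: "2 * \<gamma> * real n^2 + real n
      \<le> (\<Sum>u\<in>verts G. real (card {v \<in> verts G. f v = f u}))"
    using big sum_card_div_classes[OF m lo hi] by simp
  obtain \<pi> where \<pi>: "\<pi> permutes verts G"
    and le: "real (card (arcs G)) * (real n^2 - 2 * real n
        + (\<Sum>u\<in>verts G. real (card {v \<in> verts G. f v = f u})))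
      \<le> 2 * real n * (real n - 1)
        * real (card {e \<in> arcs G. f (\<pi> (tail G e)) \<le> f (\<pi> (head G e))})"
    using exists_placement[of f] unfolding n_def by blast
  define K where "K = {e \<in> arcs G. f (\<pi> (tail G e)) \<le> f (\<pi> (head G e))}"
  have "(2 * real n * (real n - 1)) * ((1 / 2 + \<gamma>) * real (card (arcs G)))
      = real (card (arcs G)) * ((1 + 2 * \<gamma>) * (real n^2 - real n))"
    by (simp add: power2_eq_square algebra_simps)
  also have "\<dots> \<le> real (card (arcs G)) * (real n^2 - 2 * real n
        + (\<Sum>u\<in>verts G. real (card {v \<in> verts G. f v = f u})))"
  proof (intro mult_left_mono)
    have "0 \<le> 2 * \<gamma> * real n" using \<open>0 \<le> \<gamma>\<close> by simp
    then show "(1 + 2 * \<gamma>) * (real n^2 - real n) \<le> real n^2 - 2 * real n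
        + (\<Sum>u\<in>verts G. real (card {v \<in> verts G. f v = f u}))"
      using classes by (simp add: algebra_simps)
  qed simp
  also have "\<dots> \<le> (2 * real n * (real n - 1)) * real (card K)"
    using le by (simp add: K_def)
  finally have "(1 / 2 + \<gamma>) * real (card (arcs G)) \<le> real (card K)"
    using n by (simp add: mult_le_cancel_left_pos)
  then have "nat \<lceil>(1 / 2 + \<gamma>) * real (card (arcs G))\<rceil> \<le> card K"
    by (simp add: nat_le_iff ceiling_le_iff)
  then obtain A where A: "A \<subseteq> K" "card A = nat \<lceil>(1 / 2 + \<gamma>) * real (card (arcs G))\<rceil>"
    by (metis obtain_subset_with_card_n)
  define H where "H = \<lparr>verts = verts G, arcs = A, tail = tail G, head = head G\<rparr>"
  have AG: "A \<subseteq> arcs G" using A by (auto simp: K_def)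
  interpret H: wf_digraph H
    using AG by unfold_locales (auto simp: H_def)
  have "subgraph H G"
    using AG H.wf_digraph wf_digraph by (auto simp: subgraph_def H_def compatible_def)
  moreover have "int (card (arcs H)) = \<lceil>(1 / 2 + \<gamma>) * real (card (arcs G))\<rceil>"
  proof -
    have "0 \<le> (1 / 2 + \<gamma>) * real (card (arcs G))"
      using \<open>0 \<le> \<gamma>\<close> by simp
    then have "0 \<le> \<lceil>(1 / 2 + \<gamma>) * real (card (arcs G))\<rceil>"
      by linarith
    then show ?thesis using A(2) by (simp add: H_def)
  qed
  moreover have "length c \<le> m" if c: "H.cycle c" for c
  proof -
    obtain u where u: "u \<in> verts G"
      and len: "length c \<le> card {v \<in> verts G. f (\<pi> v) = f (\<pi> u)}"
      using H.cycle_length_le_label_class[of "\<lambda>v. f (\<pi> v)" c] c A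
      by (auto simp: H_def K_def)
    have "card {v \<in> verts G. f (\<pi> v) = f (\<pi> u)} = card {v \<in> verts G. f v = f (\<pi> u)}"
    proof -
      have "\<pi> ` {v \<in> verts G. f (\<pi> v) = f (\<pi> u)} = {v \<in> verts G. f v = f (\<pi> u)}"
        using permutes_image[OF \<pi>] by auto
      moreover have "inj_on \<pi> {v \<in> verts G. f (\<pi> v) = f (\<pi> u)}"
        using permutes_inj_on[OF \<pi>] .
      ultimately show ?thesis by (simp flip: card_image)
    qed
    then have "length c \<le> card {v \<in> verts G. f v = f (\<pi> u)}"
      using len by simp
    also have "\<dots> \<le> m"
      unfolding class_eq by (rule card_div_class_le[OF m])
    finally show ?thesis .
  qed
  ultimately show ?thesis by blast
qed

lemma (in digraph) card_arcs_le: "card (arcs G) \<le> card (verts G)^2"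
proof -
  have "inj_on (arc_to_ends G) (arcs G)"
    using no_multi_arcs by (auto intro: inj_onI)
  moreover have "arc_to_ends G ` arcs G \<subseteq> verts G \<times> verts G"
    by (auto simp: arc_to_ends_def)
  ultimately have "card (arcs G) \<le> card (verts G \<times> verts G)"
    by (intro card_inj_on_le) auto
  then show ?thesis by (simp add: card_cartesian_product power2_eq_square)
qed

text \<open>
  Since \<open>q * t < 1\<close>, a positive proportion of the places lies outside the \<open>q\<close> blocks and absorbs
  their lower-order enlargement; the summand 1 allows for rounding the block size up.
\<close>

lemma eventually_block_parameters:
  fixes t :: real and q :: nat
  assumes "0 < t" and "real q * t < 1"
  shows "\<forall>\<^sub>F n::nat in sequentially. n \<ge> 2 \<and> real q * (t * real n + sqrt (real n) + 1) \<le> real n"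
proof (intro eventually_conj eventually_ge_at_top)
  have "(\<lambda>n::nat. real q * (t + sqrt (real n) / real n + 1 / real n)) \<longlonglongrightarrow> real q * (t + 0 + 0)"
    by (intro tendsto_intros; real_asymp)
  then have "\<forall>\<^sub>F n::nat in sequentially. real q * (t + sqrt (real n) / real n + 1 / real n) < 1"
    using assms by (intro order_tendstoD(2)) auto
  then show "\<forall>\<^sub>F n::nat in sequentially. real q * (t * real n + sqrt (real n) + 1) \<le> real n"
    using eventually_gt_at_top[of 0]
  proof eventually_elim
    case (elim n)
    then have "real q * (t + sqrt (real n) / real n + 1 / real n) * real n \<le> 1 * real n"
      by (intro mult_right_mono) auto
    moreover have "real q * (t + sqrt (real n) / real n + 1 / real n) * real n
        = real q * (t * real n + sqrt (real n) + 1)"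
      using elim(2) by (simp add: distrib_left distrib_right mult.assoc)
    ultimately show ?case by linarith
  qed
qed

theorem proposition7:
  fixes \<gamma> \<alpha> :: real
    and G :: "nat \<Rightarrow> ('a, 'b) pre_digraph"
    and p r :: "nat \<Rightarrow> real"
  assumes "0 < \<gamma>" and "\<gamma> < 1 / 2"
    and "0 \<le> \<alpha>" and "\<alpha> < 1"
    and "2 * \<gamma> = 1 - (1 - w \<alpha>) * (\<alpha> + w \<alpha>)"
    and "\<And>i. i \<ge> 1 \<Longrightarrow> digraph (G i)"
    and "\<And>i. i \<ge> 1 \<Longrightarrow> pseudorandom (G i) (p i) (r i)"
    and "filterlim (\<lambda>i. p i * real (card (verts (G i)))) at_top sequentially"
    and "r \<in> O(\<lambda>i. sqrt (real (card (verts (G i))) * p i))"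
  shows "\<exists>(\<epsilon> :: nat \<Rightarrow> real) (G' :: nat \<Rightarrow> ('a, 'b) pre_digraph).
    \<epsilon> \<longlonglongrightarrow> 0 \<and>
    (\<forall>i\<ge>1. subgraph (G' i) (G i)) \<and>
    (\<forall>\<^sub>F i in sequentially.
       int (card (arcs (G' i))) = \<lceil>(1 / 2 + \<gamma>) * real (card (arcs (G i)))\<rceil> \<and>
       \<not> (\<exists>c. pre_digraph.cycle (G' i) c \<and>
              real (length c) \<ge> (1 - \<alpha> + \<epsilon> i) * real (card (verts (G i)))))"
proof -
  define n where "n i = card (verts (G i))" for i
  define t where "t = 1 - \<alpha>"
  \<comment> \<open>The blocks have size less than \<open>t * n + sqrt n + 1\<close>; the constant 2 makes the inequality for
      the cycle length strict.\<close>
  define \<epsilon> where "\<epsilon> i = (sqrt (real (n i)) + 2) / real (n i)" for i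
  define good where "good i H \<longleftrightarrow> subgraph H (G i) \<and>
      int (card (arcs H)) = \<lceil>(1 / 2 + \<gamma>) * real (card (arcs (G i)))\<rceil> \<and>
      \<not> (\<exists>c. pre_digraph.cycle H c \<and> real (length c) \<ge> (t + \<epsilon> i) * real (n i))" for i H
  obtain q :: nat where q: "q \<ge> 1" "real q * t < 1" "1 \<le> (real q + 1) * t"
    and \<gamma>: "2 * \<gamma> = real q * t^2 + (1 - real q * t)^2"
    using gamma_as_block_squares[OF assms(2-5)] unfolding t_def by blast
  have t: "0 < t" using assms(4) by (simp add: t_def)

  have "p i * real (n i) \<le> real (n i)" if "i \<ge> 1" for i
  proof (cases "n i = 0")
    case False
    have "real (card (arcs (G i))) \<le> real (n i)^2"
      using digraph.card_arcs_le[OF assms(6)[OF that]] unfolding n_def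
      by (metis of_nat_le_iff of_nat_power)
    moreover have "real (card (arcs (G i))) = p i * real (n i)^2"
      using assms(7)[OF that] unfolding pseudorandom_def edge_density_def n_def by blast
    ultimately have "p i * real (n i)^2 \<le> 1 * real (n i)^2"
      by simp
    then have "p i \<le> 1"
      using False by (simp add: mult_le_cancel_right_pos)
    then show ?thesis using mult_right_mono[of "p i" 1 "real (n i)"] by simp
  qed simp
  then have "filterlim (\<lambda>i. real (n i)) at_top sequentially"
    using assms(8) unfolding n_def[symmetric]
    by (elim filterlim_at_top_mono) (auto intro: eventually_sequentiallyI[of 1])
  then have n_lim: "filterlim n at_top sequentially"
    by (simp add: filterlim_sequentially_iff_filterlim_real)

  have "(\<lambda>k::nat. (sqrt (real k) + 2) / real k) \<longlonglongrightarrow> 0"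
    by real_asymp
  then have \<epsilon>_lim: "\<epsilon> \<longlonglongrightarrow> 0"
    unfolding \<epsilon>_def by (rule filterlim_compose[OF _ n_lim])

  have "\<forall>\<^sub>F i in sequentially. n i \<ge> 2 \<and>
      real q * (t * real (n i) + sqrt (real (n i)) + 1) \<le> real (n i)"
    using eventually_compose_filterlim[OF eventually_block_parameters[OF t q(2)] n_lim] .
  then have ex_good: "\<forall>\<^sub>F i in sequentially. \<exists>H. good i H"
    using eventually_ge_at_top[of 1]
  proof eventually_elim
    case (elim i)
    define N where "N = real (n i)"
    define m where "m = nat \<lceil>t * N + sqrt N\<rceil>"
    have N: "N \<ge> 2" and room: "real q * (t * N + sqrt N + 1) \<le> N"
      using elim by (auto simp: N_def)
    have pos: "0 < t * N + sqrt N"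
      using t N by (intro add_pos_nonneg mult_pos_pos) auto
    have m_lo: "t * N + sqrt N \<le> real m" and m_hi: "real m < t * N + sqrt N + 1"
      using pos unfolding m_def by linarith+
    have "m > 0" using m_lo pos by linarith
    have "real q * real m \<le> real q * (t * N + sqrt N + 1)"
      using m_hi by (intro mult_left_mono) auto
    then have "real (q * m) \<le> real (n i)"
      using room by (simp add: N_def)
    then have lo: "q * m \<le> n i"
      by (simp only: of_nat_le_iff)
    have Nx: "N \<le> (real q + 1) * (t * N)"
      using mult_right_mono[OF q(3), of N] N by (simp add: mult.assoc)
    also have "\<dots> \<le> (real q + 1) * real m"
    proof (rule mult_left_mono)
      have "0 \<le> sqrt N" using N by simp
      then show "t * N \<le> real m" using m_lo by linarith
    qed simp
    finally have "real (n i) \<le> real ((q + 1) * m)"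
      by (simp add: N_def distrib_right)
    then have hi: "n i \<le> (q + 1) * m"
      by (simp only: of_nat_le_iff)
    have "2 * \<gamma> * N^2 = real q * (t * N)^2 + (N - real q * (t * N))^2"
      unfolding \<gamma> by algebra
    also have "\<dots> + 2 * (sqrt N)^2 \<le> real q * real m^2 + (N - real q * real m)^2"
      using q(1) Nx m_lo N by (intro block_squares_enlarged) auto
    finally have big: "2 * \<gamma> * N^2 + N \<le> real q * real m^2 + (N - real q * real m)^2"
      using N by simp
    obtain H where H: "subgraph H (G i)"
        "int (card (arcs H)) = \<lceil>(1 / 2 + \<gamma>) * real (card (arcs (G i)))\<rceil>"
        and short: "\<And>c. pre_digraph.cycle H c \<Longrightarrow> length c \<le> m"
      using digraph.exists_block_subgraph[OF assms(6)[OF elim(2)] _ less_imp_le[OF assms(1)]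
          \<open>m > 0\<close> lo[unfolded n_def] hi[unfolded n_def] big[unfolded N_def n_def]]
        elim(1) unfolding n_def by blast
    have "\<epsilon> i * N = sqrt N + 2"
      using N by (simp add: \<epsilon>_def N_def)
    then have "(t + \<epsilon> i) * N = t * N + sqrt N + 2"
      by (simp add: distrib_right)
    then have "real m < (t + \<epsilon> i) * N"
      using m_hi by simp
    then have "\<not> (t + \<epsilon> i) * real (n i) \<le> real (length c)" if "pre_digraph.cycle H c" for c
      using short[OF that] unfolding N_def by linarith
    then have "good i H"
      using H unfolding good_def by blast
    then show ?case by blast
  qed

  define G' where "G' i = (if \<exists>H. good i H then SOME H. good i H else G i)" for i
  have good_G': "good i (G' i)" if "\<exists>H. good i H" for i
    using someI_ex[OF that] that by (simp add: G'_def)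
  have "subgraph (G' i) (G i)" if "i \<ge> 1" for i
  proof (cases "\<exists>H. good i H")
    case True
    then show ?thesis using good_G' by (auto simp: good_def)
  next
    case False
    interpret digraph "G i" using assms(6)[OF that] .
    show ?thesis using False wf_digraph.subgraph_refl[OF wf_digraph] by (simp add: G'_def)
  qed
  moreover have "\<forall>\<^sub>F i in sequentially. good i (G' i)"
    using ex_good by eventually_elim (rule good_G')
  ultimately show ?thesis
    using \<epsilon>_lim by (intro exI[of _ \<epsilon>] exI[of _ G'])
      (auto simp: good_def t_def n_def elim!: eventually_mono)
qed

end
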